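(* For all integers $n\ge1$, $$\frac{d}{d\theta}A(n+1;\theta)=A(n;\theta),\qquad \frac{d}{d\theta}B(n+1;\theta)=B(n;\theta).$$
   Context: Let $\theta\in\mathbb{R}$ and let $n\ge1$ be an integer. The polylogarithm on the unit circle is $$\mathrm{Li}_n(e^{i\theta})=\sum_{k=1}^{\infty}\frac{e^{ik\theta}}{k^n}=\sum_{k=1}^{\infty}\frac{\cos(k\theta)}{k^n}+i\sum_{k=1}^{\infty}\frac{\sin(k\theta)}{k^n}.$$ The phase-normalized master function is $F_n(\theta):=i^{-n}\,\mathrm{Li}_n(e^{i\theta})$. The real-valued CL-type family $A$ and SL-type family $B$ are defined for $n\ge1$ by $$A(n;\theta):=2\,\mathrm{Re}\,F_n(\theta),\qquad B(n;\theta):=-2\,\mathrm{Im}\,F_n(\theta).$$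
   Formalization: For n=1 the points θ in 2πℤ are excluded: there Li_1(1) diverges, A(2;θ) has a corner (slopes +π and −π) and B(2;θ) has infinite slope, so the identities fail; for n≥2 every real θ is covered. *)

theory Defs
  imports "HOL-Analysis.Analysis"
begin

text \<open>
  The summation index is shifted: the \<open>j\<close>-th summand is the one for \<open>k = j + 1\<close>.
  The sum is the limit of the ordered partial sums, so for \<open>n = 1\<close> it also covers the
  conditionally convergent case \<open>norm z = 1\<close>, \<open>z \<noteq> 1\<close>.  The only point of the unit circle at
  which the series diverges for some \<open>n \<ge> 1\<close> is \<open>z = 1\<close>, for \<open>n = 1\<close>; the value is
  meaningless there.
\<close>

definition polylog :: "nat \<Rightarrow> complex \<Rightarrow> complex" where
  "polylog n z = (\<Sum>j. z ^ Suc j / of_nat (Suc j) ^ n)"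

definition master_F :: "nat \<Rightarrow> real \<Rightarrow> complex" where
  "master_F n \<theta> = \<i> powi (- int n) * polylog n (exp (\<i> * of_real \<theta>))"

definition family_A :: "nat \<Rightarrow> real \<Rightarrow> real" where
  "family_A n \<theta> = 2 * Re (master_F n \<theta>)"

definition family_B :: "nat \<Rightarrow> real \<Rightarrow> real" where
  "family_B n \<theta> = - 2 * Im (master_F n \<theta>)"

end

theory Submission imports Defs begin

text \<open>
  Differentiating the summand \<open>e\<^sup>i\<^sup>k\<^sup>t / k ^ (n + 1)\<close> with respect to \<open>t\<close> produces a factor
  \<open>\<i> * k\<close>, so formally the series of order \<open>n + 1\<close> has derivative \<open>\<i>\<close> times the series of
  order \<open>n\<close>.  The phase \<open>\<i> powi (- int n)\<close> in the master function absorbs exactly this factor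
  \<open>\<i>\<close>, so that the master function of order \<open>n + 1\<close> has that of order \<open>n\<close> as its derivative;
  the two real families are fixed real multiples of its real and imaginary part, and inherit
  the relation.

  What needs an argument is the interchange of sum and derivative: the differentiated series has
  to converge uniformly near the point in question.  For \<open>n \<ge> 2\<close> it does so on the whole circle
  by comparison with \<open>\<Sum> 1 / k ^ n\<close> (\<open>polylog_uniformly_convergent_circle\<close>).  For \<open>n = 1\<close> it
  converges only conditionally, and uniformity holds on sets that keep a positive distance from
  \<open>z = 1\<close>; this is the uniform form of Dirichlet's test for power series with decreasing
  coefficients (\<open>uniform_Dirichlet_power_series\<close>).
\<close>

section \<open>Uniform convergence\<close>

text \<open>
  Summation by parts.  Multiplication by \<open>1 - z\<close> replaces the coefficients by their differences, whose sum telescopes: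
  the partial sums of \<open>(1 - z) * (\<Sum>j. a j * z ^ Suc j)\<close> are those of a series with the summable
  majorant \<open>a j - a (Suc j)\<close>, up to a boundary term that is at most \<open>a N\<close>.  Dividing by
  \<open>1 - z\<close> preserves uniform convergence because \<open>1 - z\<close> is bounded away from \<open>0\<close>.
\<close>

lemma uniform_Dirichlet_power_series:
  fixes a :: "nat \<Rightarrow> real" and S :: "complex set"
  assumes dec: "decseq a" and lim: "a \<longlonglongrightarrow> 0"
    and le1: "\<And>z. z \<in> S \<Longrightarrow> norm z \<le> 1"
    and away: "\<And>z. z \<in> S \<Longrightarrow> c \<le> norm (1 - z)" and c: "c > 0"
  shows "uniformly_convergent_on S (\<lambda>N z. \<Sum>j<N. of_real (a j) * z ^ Suc j)"
proof -
  define d where "d j = a j - a (Suc j)" for j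
  have d_nonneg: "d j \<ge> 0" for j
    using decseqD[OF dec, of j "Suc j"] by (simp add: d_def)
  have a_nonneg: "a j \<ge> 0" for j
    using decseq_ge[OF dec lim] .
  have d_summable: "summable d"
    unfolding d_def using telescope_summable'[OF lim] by simp
  have pow: "norm (z ^ k) \<le> 1" if "z \<in> S" for z k
    using power_le_one[OF norm_ge_zero le1[OF that], of k] by (simp add: norm_power)
  have bound: "norm (of_real (d j) * z ^ Suc (Suc j)) \<le> d j" if "z \<in> S" for z j
    using mult_left_mono[OF pow[OF that, of "Suc (Suc j)"] d_nonneg[of j]] d_nonneg[of j]
    by (simp add: norm_mult)
  define D where "D z = (\<Sum>j. of_real (d j) * z ^ Suc (Suc j))" for z :: complex
  have D: "uniform_limit S (\<lambda>N z. \<Sum>j<N. of_real (d j) * z ^ Suc (Suc j)) D sequentially"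
    unfolding D_def by (rule Weierstrass_m_test[OF bound d_summable])
  have D_bound: "norm (D z) \<le> suminf d" if "z \<in> S" for z
    unfolding D_def by (rule norm_suminf_le[OF bound[OF that] d_summable])
  have boundary: "uniform_limit S (\<lambda>N z. of_real (a N) * z ^ Suc N) (\<lambda>_. 0) sequentially"
  proof (rule uniform_limitI)
    fix e :: real assume "e > 0"
    have "\<forall>\<^sub>F N in sequentially. a N < e"
      using order_tendstoD(2)[OF lim \<open>e > 0\<close>] .
    then show "\<forall>\<^sub>F N in sequentially. \<forall>z\<in>S. dist (of_real (a N) * z ^ Suc N) 0 < e"
    proof eventually_elim
      case (elim N)
      show ?case
      proof
        fix z assume "z \<in> S"
        then have "a N * norm (z ^ Suc N) \<le> a N"
          using mult_left_mono[OF pow[OF \<open>z \<in> S\<close>, of "Suc N"] a_nonneg[of N]] by simp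
        then show "dist (of_real (a N) * z ^ Suc N) 0 < e"
          using elim a_nonneg[of N] by (simp add: norm_mult)
      qed
    qed
  qed
  have by_parts: "(1 - z) * (\<Sum>j<N. of_real (a j) * z ^ Suc j) =
      of_real (a 0) * z - of_real (a N) * z ^ Suc N
        - (\<Sum>j<N. of_real (d j) * z ^ Suc (Suc j))" for z :: complex and N
    by (induction N) (simp_all add: d_def algebra_simps)
  let ?l = "\<lambda>z. of_real (a 0) * z - 0 - D z"
  have "uniform_limit S
      (\<lambda>N z. of_real (a 0) * z - of_real (a N) * z ^ Suc N
        - (\<Sum>j<N. of_real (d j) * z ^ Suc (Suc j))) ?l sequentially"
    by (intro uniform_limit_minus D boundary) (auto intro!: uniform_limitI)
  moreover have "uniform_limit S (\<lambda>N z. 1 - z) (\<lambda>z. 1 - z) sequentially"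
    by (auto intro!: uniform_limitI)
  moreover have "bounded (?l ` S)"
    unfolding bounded_iff
  proof (intro exI ballI)
    fix w assume "w \<in> ?l ` S"
    then obtain z where z: "z \<in> S" and w: "w = of_real (a 0) * z - D z" by auto
    have "norm w \<le> norm (of_real (a 0) * z) + norm (D z)"
      unfolding w by (rule norm_triangle_ineq4)
    also have "norm (of_real (a 0) * z) \<le> a 0"
      using mult_left_mono[OF le1[OF z] a_nonneg[of 0]] a_nonneg[of 0] by (simp add: norm_mult)
    finally show "norm w \<le> a 0 + suminf d"
      using D_bound[OF z] by simp
  qed
  ultimately have "uniform_limit S
      (\<lambda>N z. (of_real (a 0) * z - of_real (a N) * z ^ Suc N
        - (\<Sum>j<N. of_real (d j) * z ^ Suc (Suc j))) / (1 - z)) (\<lambda>z. ?l z / (1 - z)) sequentially"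
    by (rule uniform_lim_divide[where b = c]) (use away c in auto)
  moreover have "(of_real (a 0) * z - of_real (a N) * z ^ Suc N
        - (\<Sum>j<N. of_real (d j) * z ^ Suc (Suc j))) / (1 - z)
      = (\<Sum>j<N. of_real (a j) * z ^ Suc j)" if "z \<in> S" for z N
    using away[OF that] c unfolding by_parts[symmetric] by auto
  ultimately have "uniform_limit S (\<lambda>N z. \<Sum>j<N. of_real (a j) * z ^ Suc j)
      (\<lambda>z. ?l z / (1 - z)) sequentially"
    by (subst (asm) uniform_limit_cong') auto
  then show ?thesis
    unfolding uniformly_convergent_on_def by blast
qed

lemma norm_polylog_term:
  "norm (z ^ Suc j / of_nat (Suc j) ^ n :: complex) = 1 / real (Suc j) ^ n" if "norm z = 1"
  using that by (simp add: norm_divide norm_power norm_mult del: of_nat_Suc)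

lemma summable_inverse_Suc_power:
  "summable (\<lambda>j. 1 / real (Suc j) ^ n)" if "n \<ge> 2"
  using inverse_power_summable[OF that, where 'a = real]
  by (subst summable_Suc_iff[of "\<lambda>j. 1 / real j ^ n"]) (simp add: inverse_eq_divide)

lemma polylog_uniformly_convergent_circle:
  assumes "n \<ge> 2"
  shows "uniformly_convergent_on (sphere 0 1)
    (\<lambda>N z. \<Sum>j<N. z ^ Suc j / of_nat (Suc j) ^ n :: complex)"
  by (rule Weierstrass_m_test'[OF _ summable_inverse_Suc_power[OF assms]])
     (simp add: norm_polylog_term del: power_Suc of_nat_Suc)

lemma polylog_uniformly_convergent_away_from_1:
  assumes "n \<ge> 1" "c > 0"
  shows "uniformly_convergent_on {z. norm z = 1 \<and> c \<le> norm (1 - z)}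
    (\<lambda>N z. \<Sum>j<N. z ^ Suc j / of_nat (Suc j) ^ n :: complex)"
proof -
  have "decseq (\<lambda>j. 1 / real (Suc j) ^ n)"
    by (intro decseq_SucI divide_left_mono power_mono) auto
  moreover have "(\<lambda>j. 1 / real (Suc j) ^ n) \<longlonglongrightarrow> 0"
    using tendsto_power[OF LIMSEQ_inverse_real_of_nat, of n] assms(1)
    by (simp add: inverse_eq_divide power_divide power_0_left)
  ultimately have "uniformly_convergent_on {z. norm z = 1 \<and> c \<le> norm (1 - z)}
      (\<lambda>N z. \<Sum>j<N. of_real (1 / real (Suc j) ^ n) * z ^ Suc j :: complex)"
    by (rule uniform_Dirichlet_power_series) (use assms(2) in auto)
  then show ?thesis
    by (simp del: of_nat_Suc power_Suc)
qed

section \<open>Termwise differentiation\<close>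

text \<open>
  The Frechet derivative of a curve is the linear map \<open>\<lambda>h. h *\<^sub>R f' j t\<close>, whose operator norm is
  \<open>norm (f' j t)\<close>.  Uniform convergence of the derivatives as linear maps, which justifies
  termwise differentiation, is therefore uniform convergence of the vectors \<open>f' j t\<close>.
\<close>

lemma has_vector_derivative_series:
  fixes f :: "nat \<Rightarrow> real \<Rightarrow> 'b::banach"
  assumes S: "convex S" "open S"
    and deriv: "\<And>j t. t \<in> S \<Longrightarrow> (f j has_vector_derivative f' j t) (at t)"
    and unif: "uniformly_convergent_on S (\<lambda>N t. \<Sum>j<N. f' j t)"
    and x: "x \<in> S" "summable (\<lambda>j. f j x)"
  shows "((\<lambda>t. \<Sum>j. f j t) has_vector_derivative (\<Sum>j. f' j x)) (at x)"
proof -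
  define g' where "g' t = (\<Sum>j. f' j t)" for t
  have lim: "uniform_limit S (\<lambda>N t. \<Sum>j<N. f' j t) g' sequentially"
    using unif by (simp add: uniformly_convergent_uniform_limit_iff suminf_eq_lim g'_def[abs_def])
  have "\<exists>g. \<forall>t\<in>S. (\<lambda>j. f j t) sums g t \<and> (g has_derivative (\<lambda>h. h *\<^sub>R g' t)) (at t within S)"
  proof (rule has_derivative_series[where f = f and f' = "\<lambda>j t h. h *\<^sub>R f' j t" and x = x])
    show "convex S" "x \<in> S" "(\<lambda>j. f j x) sums (\<Sum>j. f j x)"
      using S(1) x by (simp_all add: summable_sums)
  next
    show "(f j has_derivative (\<lambda>h. h *\<^sub>R f' j t)) (at t within S)" if "t \<in> S" for j t
      using has_vector_derivative_at_within[OF deriv[OF that]]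
      by (simp add: has_vector_derivative_def)
  next
    fix e :: real assume "e > 0"
    show "\<forall>\<^sub>F N in sequentially. \<forall>t\<in>S. \<forall>h.
        norm ((\<Sum>j<N. h *\<^sub>R f' j t) - h *\<^sub>R g' t) \<le> e * norm h"
      using uniform_limitD[OF lim \<open>e > 0\<close>]
    proof eventually_elim
      case (elim N)
      show ?case
      proof (intro ballI allI)
        fix t h assume "t \<in> S"
        have "norm ((\<Sum>j<N. h *\<^sub>R f' j t) - h *\<^sub>R g' t)
            = norm h * norm ((\<Sum>j<N. f' j t) - g' t)"
          by (simp flip: scaleR_sum_right scaleR_diff_right)
        also have "\<dots> \<le> norm h * e"
          using elim \<open>t \<in> S\<close> by (intro mult_left_mono) (auto simp: dist_norm less_imp_le)
        finally show "norm ((\<Sum>j<N. h *\<^sub>R f' j t) - h *\<^sub>R g' t) \<le> e * norm h"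
          by (simp add: mult.commute)
      qed
    qed
  qed
  then obtain g where g: "\<And>t. t \<in> S \<Longrightarrow> (\<lambda>j. f j t) sums g t"
      "\<And>t. t \<in> S \<Longrightarrow> (g has_derivative (\<lambda>h. h *\<^sub>R g' t)) (at t within S)"
    by blast
  have "(g has_vector_derivative g' x) (at x)"
    using g(2)[OF x(1)] at_within_open[OF x(1) S(2)] by (simp add: has_vector_derivative_def)
  then have "((\<lambda>t. \<Sum>j. f j t) has_vector_derivative g' x) (at x)"
    by (rule has_vector_derivative_transform_within_open[OF _ S(2) x(1)])
       (use g(1) in \<open>auto simp: sums_iff\<close>)
  then show ?thesis by (simp add: g'_def)
qed

text \<open>
  Isolates the analytic input: uniform convergence of the differentiated series, of order \<open>n\<close>, on
  an arc around the point.  The series of order \<open>n + 1 \<ge> 2\<close> converges absolutely on the circle,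
  and the chain rule gives the factor \<open>\<i>\<close>.
\<close>

lemma has_vector_derivative_polylog_circle_of_uniform:
  assumes S: "convex S" "open S" "\<theta> \<in> S" and n: "n \<ge> 1"
    and unif: "uniformly_convergent_on ((\<lambda>t. exp (\<i> * of_real t)) ` S)
      (\<lambda>N z. \<Sum>j<N. z ^ Suc j / of_nat (Suc j) ^ n :: complex)"
  shows "((\<lambda>t. polylog (n + 1) (exp (\<i> * of_real t))) has_vector_derivative
    \<i> * polylog n (exp (\<i> * of_real \<theta>))) (at \<theta>)"
proof -
  let ?e = "\<lambda>t::real. exp (\<i> * of_real t)"
  let ?f = "\<lambda>j t. ?e t ^ Suc j / of_nat (Suc j) ^ (n + 1)"
  let ?f' = "\<lambda>j t. \<i> * (?e t ^ Suc j / of_nat (Suc j) ^ n)"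
  obtain l where l: "uniform_limit (?e ` S)
      (\<lambda>N z. \<Sum>j<N. z ^ Suc j / of_nat (Suc j) ^ n) l sequentially"
    using unif unfolding uniformly_convergent_on_def by blast
  have "uniform_limit S (\<lambda>N t. \<Sum>j<N. ?e t ^ Suc j / of_nat (Suc j) ^ n)
      (\<lambda>t. l (?e t)) sequentially"
    by (rule uniform_limit_compose'[OF l]) auto
  then have "uniformly_convergent_on S (\<lambda>N t. \<Sum>j<N. ?e t ^ Suc j / of_nat (Suc j) ^ n)"
    unfolding uniformly_convergent_on_def by blast
  from uniformly_convergent_mult[OF this, of \<i>]
  have unif': "uniformly_convergent_on S (\<lambda>N t. \<Sum>j<N. ?f' j t)"
    by (simp only: sum_distrib_left)
  have deriv: "(?f j has_vector_derivative ?f' j t) (at t)" for j t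
  proof -
    have "((\<lambda>z. exp (\<i> * z) ^ Suc j / of_nat (Suc j) ^ (n + 1)) has_field_derivative
        of_nat (Suc j) * (exp (\<i> * of_real t) ^ j * (exp (\<i> * of_real t) * \<i>))
          / of_nat (Suc j) ^ (n + 1)) (at (of_real t))"
      by (auto intro!: derivative_eq_intros simp del: power_Suc of_nat_Suc)
    then have "(?f j has_vector_derivative
        of_nat (Suc j) * (exp (\<i> * of_real t) ^ j * (exp (\<i> * of_real t) * \<i>))
          / of_nat (Suc j) ^ (n + 1)) (at t)"
      by (rule has_vector_derivative_real_field)
    also have "of_nat (Suc j) * (exp (\<i> * of_real t) ^ j * (exp (\<i> * of_real t) * \<i>))
          / of_nat (Suc j) ^ (n + 1) = ?f' j t"
      by (simp add: divide_simps del: of_nat_Suc)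
    finally show ?thesis .
  qed
  have "summable (\<lambda>j. ?f j \<theta>)"
    using n by (intro summable_norm_cancel[of "\<lambda>j. ?f j \<theta>"])
      (subst norm_polylog_term, simp, rule summable_inverse_Suc_power, simp)
  from has_vector_derivative_series[OF S(1,2) deriv unif' S(3) this]
  have "((\<lambda>t. \<Sum>j. ?f j t) has_vector_derivative (\<Sum>j. ?f' j \<theta>)) (at \<theta>)" .
  moreover have "summable (\<lambda>j. ?e \<theta> ^ Suc j / of_nat (Suc j) ^ n)"
    using tendsto_uniform_limitI[OF l, of "?e \<theta>"] S(3)
    by (auto simp: summable_iff_convergent convergent_def)
  ultimately show ?thesis
    unfolding polylog_def by (simp only: suminf_mult)
qed

text \<open>
  The case distinction is between conditional and absolute convergence of the differentiated
  series.  For \<open>n = 1\<close> the point has to be kept away from the singularity at \<open>1\<close>.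
\<close>

lemma has_vector_derivative_polylog_circle:
  assumes "n \<ge> 1" and "n = 1 \<Longrightarrow> exp (\<i> * of_real \<theta>) \<noteq> 1"
  shows "((\<lambda>t. polylog (n + 1) (exp (\<i> * of_real t))) has_vector_derivative
    \<i> * polylog n (exp (\<i> * of_real \<theta>))) (at \<theta>)"
proof (cases "n = 1")
  case True
  let ?r = "\<lambda>t::real. norm (1 - exp (\<i> * of_real t))"
  have pos: "?r \<theta> > 0" using assms(2) True by simp
  \<comment> \<open>By continuity, a short arc around the point stays half as far from \<open>1\<close> as the point.\<close>
  have "isCont ?r \<theta>" by (intro continuous_intros)
  then have "(?r \<longlongrightarrow> ?r \<theta>) (nhds \<theta>)"
    using tendsto_at_iff_tendsto_nhds[of ?r \<theta>] by (simp only: isCont_def)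
  then have "\<forall>\<^sub>F t in nhds \<theta>. ?r \<theta> / 2 < ?r t"
    by (rule order_tendstoD(1)) (use pos in linarith)
  then obtain \<delta> where \<delta>: "\<delta> > 0" "\<And>t. dist t \<theta> < \<delta> \<Longrightarrow> ?r \<theta> / 2 < ?r t"
    unfolding eventually_nhds_metric by blast
  show ?thesis
  proof (rule has_vector_derivative_polylog_circle_of_uniform[of "ball \<theta> \<delta>"])
    show "uniformly_convergent_on ((\<lambda>t. exp (\<i> * of_real t)) ` ball \<theta> \<delta>)
        (\<lambda>N z. \<Sum>j<N. z ^ Suc j / of_nat (Suc j) ^ n :: complex)"
      by (rule uniformly_convergent_on_subset[OF
            polylog_uniformly_convergent_away_from_1[OF assms(1), of "?r \<theta> / 2"]])
         (use pos \<delta> in \<open>auto simp: dist_commute less_imp_le\<close>)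
  qed (use \<delta>(1) assms(1) in auto)
next
  case False
  show ?thesis
  proof (rule has_vector_derivative_polylog_circle_of_uniform[of UNIV])
    show "uniformly_convergent_on (range (\<lambda>t::real. exp (\<i> * of_real t)))
        (\<lambda>N z. \<Sum>j<N. z ^ Suc j / of_nat (Suc j) ^ n :: complex)"
      by (rule uniformly_convergent_on_subset[OF polylog_uniformly_convergent_circle])
         (use False assms(1) in auto)
  qed (use assms(1) in auto)
qed

section \<open>The master function and its real families\<close>

lemma has_vector_derivative_master_F:
  assumes "n \<ge> 1" and "n = 1 \<Longrightarrow> exp (\<i> * of_real \<theta>) \<noteq> 1"
  shows "(master_F (n + 1) has_vector_derivative master_F n \<theta>) (at \<theta>)"
proof -
  have "\<i> powi (- int (n + 1)) * \<i> = \<i> powi (- int n)"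
    using power_int_add[of \<i> "- int (n + 1)" 1] by simp
  moreover have "(master_F (n + 1) has_vector_derivative
      \<i> powi (- int (n + 1)) * (\<i> * polylog n (exp (\<i> * of_real \<theta>)))) (at \<theta>)"
    unfolding master_F_def[abs_def]
    by (intro has_vector_derivative_mult_right has_vector_derivative_polylog_circle assms)
  ultimately show ?thesis
    by (simp only: master_F_def mult.assoc[symmetric])
qed

theorem proposition2p2:
  fixes n :: nat and \<theta> :: real
  assumes "n \<ge> 1"
    and "n = 1 \<Longrightarrow> \<forall>m::int. \<theta> \<noteq> 2 * pi * of_int m"
  shows "(family_A (n + 1) has_real_derivative family_A n \<theta>) (at \<theta>) \<and>
         (family_B (n + 1) has_real_derivative family_B n \<theta>) (at \<theta>)"
proof -
  have "exp (\<i> * of_real \<theta>) \<noteq> 1" if "n = 1"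
    using assms(2)[OF that] by (auto simp: exp_eq_1 mult_ac)
  then have F: "(master_F (n + 1) has_vector_derivative master_F n \<theta>) (at \<theta>)"
    by (intro has_vector_derivative_master_F assms(1))
  have "((\<lambda>t. Re (master_F (n + 1) t)) has_real_derivative Re (master_F n \<theta>)) (at \<theta>)"
    "((\<lambda>t. Im (master_F (n + 1) t)) has_real_derivative Im (master_F n \<theta>)) (at \<theta>)"
    using bounded_linear.has_vector_derivative[OF bounded_linear_Re F]
      bounded_linear.has_vector_derivative[OF bounded_linear_Im F]
    by (simp_all add: has_real_derivative_iff_has_vector_derivative)
  from DERIV_cmult[OF this(1), of 2] DERIV_cmult[OF this(2), of "- 2"]
  show ?thesis
    unfolding family_A_def[abs_def] family_B_def[abs_def] by blast
qed

end
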